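(* Let $A \in \mathbb{R}^{n_x\times n_x}$ and let $(w_k)_{k\in\mathbb{N}}$ be a sequence of random vectors in $\mathbb{R}^{n_x}$, independent and identically distributed over time, with $\mathbb{E}[w_k]=0$ and $\mathbb{E}[w_k w_k^\top]=\Sigma^w$, where $\Sigma^w \preceq_L \nu \mathbb{I}$ for some $\nu\in\mathbb{R}_+$, $\nu<\infty$. Suppose that the autonomous nominal dynamics $z_{k+1}=Az_k$ are asymptotically stable and that $P\in\mathbb{R}^{n_x\times n_x}$, $P=P^\top\succ 0$, is such that $z\mapsto z^\top P z$ is a Lyapunov function for $z_{k+1}=Az_k$ with $A^\top P A - P \prec 0$. Then the autonomous disturbed system $x_{k+1}=Ax_k+w_k$ is input-to-state stable in probability (ISSp) with respect to $L^2$, and $V(x)=x^\top P x$ is an ISSp Lyapunov function for this system (on $\mathbb{R}^{n_x}$, with $p=2$).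
   Context: Notation: $C\preceq_L D$ (Loewner order) means $D-C$ is positive semi-definite; $\mathbb{I}$ is the identity matrix. $\mathcal{K}$, $\mathcal{K}_\infty$, $\mathcal{KL}$ are the standard comparison function classes. $L^p$: for $p>0$, a random vector $\chi$ belongs to $L^p$ if $\|\chi\|_{L^p}:=\mathbb{E}[\|\chi\|^p]^{1/p}<\infty$. Since $w_k$ is i.i.d. over time, write $\|w\|_{L^p}:=\|w_k\|_{L^p}$ for all $k$. Under the stated assumptions $w_k\in L^2$ with $\|w\|_{L^2}=\sqrt{\mathrm{Tr}(\Sigma^w)}$. ISSp: a system $x_{k+1}=f(x_k,w_k)$ is input-to-state stable in probability with respect to $L^p$ if for any $\varepsilon\in(0,1)$, $M\in\mathbb{N}$ and $w_k\in L^p$ there exist functions $\beta\in\mathcal{KL}$ and $\rho\in\mathcal{K}$ such that $$\mathbb{P}\big[\|x_{k+i}\|\le \beta(\|x_k\|,i)+\rho(\|w\|_{L^p}),\ \forall i\le M\big]\ge 1-\varepsilon .$$ ISSp Lyapunov function: a continuous function $V:\mathbb{R}^{n_x}\to[0,\infty)$ is an ISSp Lyapunov function for $x_{k+1}=f(x_k,w_k)$ on $\Omega\subseteq\mathbb{R}^{n_x}$ if there exist $\alpha_1,\alpha_2,\kappa\in\mathcal{K}_\infty$ and $\varphi\in\mathcal{K}$ such that $$\alpha_1(\|x_k\|)\le V(x_k)\le\alpha_2(\|x_k\|),$$ $$\mathbb{E}[V(x_{k+1})-V(x_k)\mid x_k]\le-\kappa(V(x_k))+\varphi(\|w\|_{L^p})$$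 hold for all $x_k\in\Omega$ and $w_k\in L^p$. Here the disturbances considered are those satisfying the hypotheses on $(w_k)$ in the claim. *)

theory Defs
  imports "HOL-Analysis.Analysis" "HOL-Probability.Probability"
begin

subsection \<open>Comparison functions\<close>

text \<open>Comparison functions are only constrained on nonnegative arguments.\<close>

definition class_K :: "(real \<Rightarrow> real) \<Rightarrow> bool" where
  "class_K \<alpha> \<longleftrightarrow> continuous_on {0..} \<alpha> \<and> strict_mono_on {0..} \<alpha> \<and> \<alpha> 0 = 0"

definition class_K_inf :: "(real \<Rightarrow> real) \<Rightarrow> bool" where
  "class_K_inf \<alpha> \<longleftrightarrow> class_K \<alpha> \<and> filterlim \<alpha> at_top at_top"

definition class_KL :: "(real \<Rightarrow> real \<Rightarrow> real) \<Rightarrow> bool" where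
  "class_KL \<beta> \<longleftrightarrow>
     continuous_on ({0..} \<times> {0..}) (\<lambda>(r, t). \<beta> r t) \<and>
     (\<forall>t\<ge>0. class_K (\<lambda>r. \<beta> r t)) \<and>
     (\<forall>r\<ge>0. antimono_on {0..} (\<beta> r) \<and> (\<beta> r \<longlongrightarrow> 0) at_top)"

subsection \<open>Definite matrices and the Loewner order\<close>

definition pos_semidefinite :: "real^'n^'n \<Rightarrow> bool" where
  "pos_semidefinite A \<longleftrightarrow> transpose A = A \<and> (\<forall>x. 0 \<le> x \<bullet> (A *v x))"

definition pos_definite :: "real^'n^'n \<Rightarrow> bool" where
  "pos_definite A \<longleftrightarrow> transpose A = A \<and> (\<forall>x. x \<noteq> 0 \<longrightarrow> 0 < x \<bullet> (A *v x))"

definition loewner_le :: "real^'n^'n \<Rightarrow> real^'n^'n \<Rightarrow> bool" where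
  "loewner_le C D \<longleftrightarrow> pos_semidefinite (D - C)"

subsection \<open>Nominal (undisturbed) systems\<close>

definition asymptotically_stable :: "('x::real_normed_vector \<Rightarrow> 'x) \<Rightarrow> bool" where
  "asymptotically_stable g \<longleftrightarrow>
     (\<forall>\<epsilon>>0. \<exists>\<delta>>0. \<forall>z. norm z < \<delta> \<longrightarrow> (\<forall>k. norm ((g ^^ k) z) < \<epsilon>)) \<and>
     (\<exists>\<delta>>0. \<forall>z. norm z < \<delta> \<longrightarrow> (\<lambda>k. (g ^^ k) z) \<longlonglongrightarrow> 0)"

definition lyapunov_function :: "('x::real_normed_vector \<Rightarrow> 'x) \<Rightarrow> ('x \<Rightarrow> real) \<Rightarrow> bool" where
  "lyapunov_function g V \<longleftrightarrow>
     continuous_on UNIV V \<and> V 0 = 0 \<and> (\<forall>z. z \<noteq> 0 \<longrightarrow> 0 < V z \<and> V (g z) - V z < 0)"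

subsection \<open>Disturbances\<close>

definition in_Lp :: "'a measure \<Rightarrow> real \<Rightarrow> ('a \<Rightarrow> 'x::euclidean_space) \<Rightarrow> bool" where
  "in_Lp \<Omega> p X \<longleftrightarrow> X \<in> borel_measurable \<Omega> \<and> integrable \<Omega> (\<lambda>\<omega>. norm (X \<omega>) powr p)"

definition Lp_norm :: "'a measure \<Rightarrow> real \<Rightarrow> ('a \<Rightarrow> 'x::euclidean_space) \<Rightarrow> real" where
  "Lp_norm \<Omega> p X = (\<integral>\<omega>. norm (X \<omega>) powr p \<partial>\<Omega>) powr (1 / p)"

definition iid_process :: "'a measure \<Rightarrow> (nat \<Rightarrow> 'a \<Rightarrow> 'x::euclidean_space) \<Rightarrow> bool" where
  "iid_process \<Omega> w \<longleftrightarrow>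
     prob_space \<Omega> \<and>
     prob_space.indep_vars \<Omega> (\<lambda>_. borel) w UNIV \<and>
     (\<forall>k. distr \<Omega> borel (w k) = distr \<Omega> borel (w 0))"

text \<open>
  A class of disturbances is a predicate on pairs of a probability space and a process on it, so
  that bounds required to be uniform over the class are also uniform over the probability space.
  The following class consists of the processes with \<open>E[w\<^sub>k] = 0\<close> and
  \<open>E[w\<^sub>k w\<^sub>k\<^sup>T] = \<Sigma>\<close>, where \<open>\<Sigma>\<close> is bounded by \<open>\<nu> I\<close> in the Loewner order for some \<open>\<nu> \<ge> 0\<close>.
\<close>

definition zero_mean_bounded_cov :: "'a measure \<Rightarrow> (nat \<Rightarrow> 'a \<Rightarrow> real^'n) \<Rightarrow> bool" where
  "zero_mean_bounded_cov \<Omega> w \<longleftrightarrow>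
     (\<exists>\<Sigma> \<nu>. (\<forall>k. has_bochner_integral \<Omega> (w k) 0 \<and>
                 has_bochner_integral \<Omega> (\<lambda>\<omega>. \<chi> i j. w k \<omega> $ i * w k \<omega> $ j) \<Sigma>) \<and>
             0 \<le> \<nu> \<and> loewner_le \<Sigma> (\<nu> *\<^sub>R mat 1))"

subsection \<open>Disturbed systems\<close>

text \<open>
  Solutions of \<open>x\<^sub>k\<^sub>+\<^sub>1 = f(x\<^sub>k, w\<^sub>k)\<close> started from an initial state which is independent of the
  disturbances; this includes all deterministic initial states.
\<close>

definition trajectory ::
  "'a measure \<Rightarrow> ('x::euclidean_space \<Rightarrow> 'x \<Rightarrow> 'x) \<Rightarrow> (nat \<Rightarrow> 'a \<Rightarrow> 'x) \<Rightarrow> (nat \<Rightarrow> 'a \<Rightarrow> 'x) \<Rightarrow> bool" where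
  "trajectory \<Omega> f w x \<longleftrightarrow>
     prob_space.indep_vars \<Omega> (\<lambda>_. borel) (case_nat (x 0) w) UNIV \<and>
     (\<forall>k. \<forall>\<omega>\<in>space \<Omega>. x (Suc k) \<omega> = f (x k \<omega>) (w k \<omega>))"

text \<open>
  \<open>W\<close> is the class of disturbances under consideration. As disturbances are identically distributed,
  their \<open>L\<^sup>p\<close> norm is that of \<open>w 0\<close>. The comparison functions may depend on the disturbance, but
  neither on the trajectory nor on the time \<open>k\<close>.
\<close>

definition ISSp ::
  "real \<Rightarrow> ('a measure \<Rightarrow> (nat \<Rightarrow> 'a \<Rightarrow> 'x) \<Rightarrow> bool) \<Rightarrow> ('x::euclidean_space \<Rightarrow> 'x \<Rightarrow> 'x) \<Rightarrow> bool" where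
  "ISSp p W f \<longleftrightarrow>
     (\<forall>\<epsilon>\<in>{0<..<1}. \<forall>N. \<forall>\<Omega> w.
        iid_process \<Omega> w \<and> W \<Omega> w \<and> (\<forall>k. in_Lp \<Omega> p (w k)) \<longrightarrow>
        (\<exists>\<beta> \<rho>. class_KL \<beta> \<and> class_K \<rho> \<and>
           (\<forall>x k. trajectory \<Omega> f w x \<longrightarrow>
              measure \<Omega> {\<omega> \<in> space \<Omega>.
                \<forall>i\<le>N. norm (x (k + i) \<omega>) \<le> \<beta> (norm (x k \<omega>)) (real i) + \<rho> (Lp_norm \<Omega> p (w 0))}
              \<ge> 1 - \<epsilon>)))"

text \<open>
  In the decrease condition, \<open>vimage_algebra (space \<Omega>) (x k) borel\<close> is the sigma-algebra generated
  by \<open>x\<^sub>k\<close>. The state \<open>x\<^sub>k\<close> is any state of a trajectory that lies in \<open>S\<close> almost surely and for which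
  \<open>V(x\<^sub>k)\<close> is integrable; with \<open>k = 0\<close> this includes every deterministic state in \<open>S\<close>. Since
  \<^const>\<open>real_cond_exp\<close> is only meaningful for integrable functions, integrability of
  \<open>V(x\<^sub>k\<^sub>+\<^sub>1)\<close> is part of the condition.
\<close>

definition ISSp_lyapunov_function ::
  "real \<Rightarrow> ('a measure \<Rightarrow> (nat \<Rightarrow> 'a \<Rightarrow> 'x) \<Rightarrow> bool) \<Rightarrow> ('x::euclidean_space \<Rightarrow> 'x \<Rightarrow> 'x) \<Rightarrow>
   'x set \<Rightarrow> ('x \<Rightarrow> real) \<Rightarrow> bool" where
  "ISSp_lyapunov_function p W f S V \<longleftrightarrow>
     continuous_on UNIV V \<and> (\<forall>x. 0 \<le> V x) \<and>
     (\<exists>\<alpha>1 \<alpha>2 \<kappa> \<phi>. class_K_inf \<alpha>1 \<and> class_K_inf \<alpha>2 \<and> class_K_inf \<kappa> \<and> class_K \<phi> \<and>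
        (\<forall>x\<in>S. \<alpha>1 (norm x) \<le> V x \<and> V x \<le> \<alpha>2 (norm x)) \<and>
        (\<forall>\<Omega> w x k.
           iid_process \<Omega> w \<and> W \<Omega> w \<and> (\<forall>j. in_Lp \<Omega> p (w j)) \<and> trajectory \<Omega> f w x \<and>
           (AE \<omega> in \<Omega>. x k \<omega> \<in> S) \<and> integrable \<Omega> (\<lambda>\<omega>. V (x k \<omega>)) \<longrightarrow>
           integrable \<Omega> (\<lambda>\<omega>. V (x (Suc k) \<omega>)) \<and>
           (AE \<omega> in \<Omega>.
              real_cond_exp \<Omega> (vimage_algebra (space \<Omega>) (x k) borel)
                (\<lambda>\<omega>'. V (x (Suc k) \<omega>') - V (x k \<omega>')) \<omega>
              \<le> - \<kappa> (V (x k \<omega>)) + \<phi> (Lp_norm \<Omega> p (w 0)))))"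

end

theory Submission
  imports Defs
begin

text \<open>
  Everything rests on the contraction \<open>V (A z) \<le> (1 - c) V z\<close>. As the noise is centred and
  independent of the current state, the cross term of \<open>V (A x + w)\<close> has conditional expectation zero,
  so \<open>E[V x\<^sub>k\<^sub>+\<^sub>1 | x\<^sub>k] = V (A x\<^sub>k) + E[V w]\<close>, which gives the dissipation inequality. For ISSp, the
  contraction yields \<open>\<parallel>A\<^sup>i z\<parallel> \<le> C \<lambda>\<^sup>i \<parallel>z\<parallel>\<close>, hence pathwise
  \<open>\<parallel>x\<^sub>k\<^sub>+\<^sub>i\<parallel> \<le> C \<lambda>\<^sup>i \<parallel>x\<^sub>k\<parallel> + C \<Sum>\<^sub>j\<^sub><\<^sub>N \<parallel>w\<^sub>k\<^sub>+\<^sub>j\<parallel>\<close> for all \<open>i \<le> N\<close>, and the last sum has expectation at most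
  \<open>C N \<parallel>w\<parallel>\<close>, so that Markov's inequality bounds it by a multiple of \<open>\<parallel>w\<parallel>\<close> with high probability.
\<close>

subsection \<open>Comparison functions\<close>

lemma class_K_linear: "0 < c \<Longrightarrow> class_K (\<lambda>r. c * r)"
  unfolding class_K_def by (auto intro!: continuous_intros strict_mono_onI)

lemma class_K_square: "0 < c \<Longrightarrow> class_K (\<lambda>r. c * r\<^sup>2)"
  unfolding class_K_def by (auto intro!: continuous_intros strict_mono_onI power_strict_mono)

lemma class_K_inf_linear: "0 < c \<Longrightarrow> class_K_inf (\<lambda>r. c * r)"
  unfolding class_K_inf_def
  by (auto intro!: class_K_linear filterlim_tendsto_pos_mult_at_top[OF tendsto_const] filterlim_ident)

lemma class_K_inf_square: "0 < c \<Longrightarrow> class_K_inf (\<lambda>r. c * r\<^sup>2)"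
  unfolding class_K_inf_def
  by (auto intro!: class_K_square filterlim_tendsto_pos_mult_at_top[OF tendsto_const]
      filterlim_pow_at_top filterlim_ident)

text \<open>The shape of \<open>\<beta>\<close> that a geometric decay produces; the exponential
  extends the rate from steps to all real times \<open>t\<close>.\<close>

lemma class_KL_exponential:
  assumes "0 < c" "0 < \<gamma>"
  shows "class_KL (\<lambda>r t. c * r * exp (- \<gamma> * t))"
  unfolding class_KL_def
proof (intro conjI allI impI)
  show "continuous_on ({0..} \<times> {0..}) (\<lambda>(r, t). c * r * exp (- \<gamma> * t))"
    by (auto simp: case_prod_unfold intro!: continuous_intros)
  show "class_K (\<lambda>r. c * r * exp (- \<gamma> * t))" for t
    using class_K_linear[of "c * exp (- \<gamma> * t)"] assms by (simp add: mult_ac)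
  show "antimono_on {0..} (\<lambda>t. c * r * exp (- \<gamma> * t))" if "0 \<le> r" for r
    using assms that by (intro monotone_onI) (auto intro!: mult_left_mono)
  have "((\<lambda>t. exp (- (\<gamma> * t))) \<longlongrightarrow> 0) at_top"
    using assms
    by (intro filterlim_compose[OF exp_at_bot] filterlim_compose[OF filterlim_uminus_at_bot_at_top]
        filterlim_tendsto_pos_mult_at_top[OF tendsto_const] filterlim_ident)
  then show "((\<lambda>t. c * r * exp (- \<gamma> * t)) \<longlongrightarrow> 0) at_top" for r
    by (auto intro!: tendsto_mult_right_zero)
qed

subsection \<open>Quadratic forms\<close>

text \<open>The form attains its minimum on the compact unit sphere; definiteness makes it positive,
  and homogeneity of degree 2 carries the bound to all vectors.\<close>

lemma pos_definite_lower_bound: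
  assumes "pos_definite (Q :: real^'n^'n)"
  obtains m where "0 < m" "\<And>x. m * (norm x)\<^sup>2 \<le> x \<bullet> (Q *v x)"
proof -
  have "continuous_on (sphere 0 1) (\<lambda>x. x \<bullet> (Q *v x))"
    by (intro continuous_intros matrix_vector_mult_linear_continuous_on)
  \<comment> \<open>Some unit vector is needed because the minimum is attained only on a nonempty
    sphere.\<close>
  moreover have "(axis undefined 1 :: real^'n) \<in> sphere 0 1"
    by (simp add: norm_axis_1)
  ultimately obtain u where u: "u \<in> sphere 0 1"
    and min: "\<And>y. y \<in> sphere 0 1 \<Longrightarrow> u \<bullet> (Q *v u) \<le> y \<bullet> (Q *v y)"
    using continuous_attains_inf[OF compact_sphere, of "0 :: real^'n" 1] by blast
  show thesis
  proof
    show "0 < u \<bullet> (Q *v u)"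
    proof -
      have "u \<noteq> 0" using u by auto
      then show ?thesis using assms by (simp add: pos_definite_def)
    qed
    show "u \<bullet> (Q *v u) * (norm x)\<^sup>2 \<le> x \<bullet> (Q *v x)" for x
    proof (cases "x = 0")
      case False
      then have "u \<bullet> (Q *v u) \<le> (x /\<^sub>R norm x) \<bullet> (Q *v (x /\<^sub>R norm x))"
        by (intro min) simp
      with False show ?thesis
        by (simp add: matrix_vector_mult_scaleR power2_eq_square field_simps)
    qed simp
  qed
qed

lemma quadratic_form_upper_bound:
  obtains M where "0 < M" "\<And>x. \<bar>x \<bullet> ((Q :: real^'n^'n) *v x)\<bar> \<le> M * (norm x)\<^sup>2"
proof -
  obtain K where K: "0 < K" "\<And>x. norm (Q *v x) \<le> norm x * K"
    using bounded_linear.pos_bounded[OF matrix_vector_mul_bounded_linear[of Q]] by auto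
  have "\<bar>x \<bullet> (Q *v x)\<bar> \<le> K * (norm x)\<^sup>2" for x
    using order_trans[OF Cauchy_Schwarz_ineq2[of x "Q *v x"] mult_left_mono[OF K(2)[of x]]]
    by (simp add: power2_eq_square mult_ac)
  with K(1) show thesis by (rule that)
qed

text \<open>Symmetry merges the two mixed terms into one that is linear in \<open>w\<close>, so that
  a centred \<open>w\<close> makes it vanish in the mean.\<close>

lemma quadratic_form_add:
  assumes "transpose P = (P :: real^'n^'n)"
  shows "(y + w) \<bullet> (P *v (y + w)) = y \<bullet> (P *v y) + 2 * (w \<bullet> (P *v y)) + w \<bullet> (P *v w)"
proof -
  have "y \<bullet> (P *v w) = w \<bullet> (P *v y)"
    by (metis assms dot_lmul_matrix inner_commute transpose_matrix_vector)
  then show ?thesis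
    by (simp add: matrix_vector_right_distrib inner_add_left inner_add_right)
qed

section \<open>Exponential decay of the nominal dynamics and its perturbation\<close>

text \<open>One step lowers the form by at least \<open>q * (norm z)\<^sup>2\<close>, and the form
  itself is at most a multiple of \<open>(norm z)\<^sup>2\<close>, so the decrease is a fixed
  fraction of the current value.\<close>

lemma quadratic_lyapunov_contraction:
  fixes A P :: "real^'n^'n"
  assumes "pos_definite P" "pos_definite (- (transpose A ** P ** A - P))"
  obtains c where "0 < c" "c < 1"
    "\<And>z. (A *v z) \<bullet> (P *v (A *v z)) \<le> (1 - c) * (z \<bullet> (P *v z))"
proof -
  obtain q where q: "0 < q"
    "\<And>z. q * (norm z)\<^sup>2 \<le> z \<bullet> ((- (transpose A ** P ** A - P)) *v z)"
    using pos_definite_lower_bound[OF assms(2)] by blast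
  obtain M where M: "0 < M" "\<And>z. \<bar>z \<bullet> (P *v z)\<bar> \<le> M * (norm z)\<^sup>2"
    using quadratic_form_upper_bound[of P] by blast
  \<comment> \<open>With \<open>q / M\<close> the fraction could equal 1, for instance if A = 0;
    adding \<open>q\<close> to the denominator keeps it below 1, so that \<open>ln (1 - c)\<close>
    makes sense later.\<close>
  let ?c = "q / (M + q)"
  have "(A *v z) \<bullet> (P *v (A *v z)) \<le> (1 - ?c) * (z \<bullet> (P *v z))" for z
  proof -
    have "z \<bullet> (P *v z) \<le> (M + q) * (norm z)\<^sup>2"
      using M(2)[of z] q(1) by (simp add: distrib_right add_increasing2)
    then have "?c * (z \<bullet> (P *v z)) \<le> ?c * ((M + q) * (norm z)\<^sup>2)"
      using q(1) M(1) by (intro mult_left_mono) auto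
    also have "\<dots> = q * (norm z)\<^sup>2"
      using q(1) M(1) by simp
    also have "\<dots> \<le> z \<bullet> (P *v z) - (A *v z) \<bullet> (P *v (A *v z))"
    proof -
      have "z \<bullet> ((transpose A ** P ** A) *v z) = (A *v z) \<bullet> (P *v (A *v z))"
        by (metis dot_lmul_matrix matrix_vector_mul_assoc transpose_matrix_vector transpose_transpose)
      then show ?thesis
        using q(2)[of z] by (simp add: matrix_vector_mult_diff_rdistrib inner_diff_right)
    qed
    finally show ?thesis
      by (simp add: algebra_simps)
  qed
  moreover have "0 < ?c" "?c < 1"
    using q(1) M(1) by auto
  ultimately show thesis by (intro that)
qed

text \<open>Iterating the contraction gives geometric decay of the form, which is comparable to the
  squared norm from both sides.\<close>

lemma quadratic_lyapunov_power_bound: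
  fixes A P :: "real^'n^'n"
  assumes "pos_definite P" "pos_definite (- (transpose A ** P ** A - P))"
  obtains C \<gamma> where "0 < C" "0 < \<gamma>"
    "\<And>i z. norm (((*v) A ^^ i) z) \<le> C * norm z * exp (- \<gamma> * real i)"
proof -
  obtain c where c: "0 < c" "c < 1"
    "\<And>z. (A *v z) \<bullet> (P *v (A *v z)) \<le> (1 - c) * (z \<bullet> (P *v z))"
    using quadratic_lyapunov_contraction[OF assms] by blast
  obtain m where m: "0 < m" "\<And>z. m * (norm z)\<^sup>2 \<le> z \<bullet> (P *v z)"
    using pos_definite_lower_bound[OF assms(1)] by blast
  obtain M where M: "0 < M" "\<And>z. \<bar>z \<bullet> (P *v z)\<bar> \<le> M * (norm z)\<^sup>2"
    using quadratic_form_upper_bound[of P] by blast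
  \<comment> \<open>Half the rate of the form, since the form is quadratic in the norm:
    \<open>(exp (- \<gamma> * real i))\<^sup>2 = (1 - c) ^ i\<close>.\<close>
  define \<gamma> where "\<gamma> = - ln (1 - c) / 2"
  have V: "((*v) A ^^ i) z \<bullet> (P *v ((*v) A ^^ i) z) \<le> (1 - c) ^ i * (z \<bullet> (P *v z))" for i z
  proof (induction i)
    case (Suc i)
    have "((*v) A ^^ Suc i) z \<bullet> (P *v ((*v) A ^^ Suc i) z)
        \<le> (1 - c) * (((*v) A ^^ i) z \<bullet> (P *v ((*v) A ^^ i) z))"
      using c(3) by simp
    also have "\<dots> \<le> (1 - c) * ((1 - c) ^ i * (z \<bullet> (P *v z)))"
      using c(2) by (intro mult_left_mono Suc) simp
    finally show ?case by simp
  qed simp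
  have "norm (((*v) A ^^ i) z) \<le> sqrt (M / m) * norm z * exp (- \<gamma> * real i)" for i z
  proof (rule power2_le_imp_le)
    have "m * (norm (((*v) A ^^ i) z))\<^sup>2 \<le> (1 - c) ^ i * (z \<bullet> (P *v z))"
      using m(2) V order_trans by blast
    also have "\<dots> \<le> (1 - c) ^ i * (M * (norm z)\<^sup>2)"
      using c(2) M(2)[of z] by (intro mult_left_mono) auto
    also have "(1 - c) ^ i = (exp (- \<gamma> * real i))\<^sup>2"
    proof -
      have "(exp (- \<gamma> * real i))\<^sup>2 = exp (real i * ln (1 - c))"
        by (simp add: \<gamma>_def flip: exp_double)
      then show ?thesis
        using c(2) by (simp add: exp_of_nat_mult)
    qed
    finally show "(norm (((*v) A ^^ i) z))\<^sup>2 \<le> (sqrt (M / m) * norm z * exp (- \<gamma> * real i))\<^sup>2"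
      using m(1) M(1) by (simp add: power_mult_distrib field_simps)
  qed (use m(1) M(1) in simp)
  moreover have "0 < \<gamma>" "0 < sqrt (M / m)"
    using c m(1) M(1) by (auto simp: \<gamma>_def)
  ultimately show thesis by (intro that)
qed

text \<open>By linearity each input is propagated by a power of A, and all powers are bounded by C.
  The induction splits off the first input, which avoids an explicit variation-of-constants
  sum.\<close>

lemma linear_recursion_perturbation_bound:
  fixes A :: "real^'n^'n"
  assumes "\<And>i z. norm (((*v) A ^^ i) z) \<le> C * norm z"
    and "\<And>n. y (Suc n) = A *v y n + u n"
  shows "norm (y i - ((*v) A ^^ i) (y 0)) \<le> C * (\<Sum>j<i. norm (u j))"
  using assms(2)
\<comment> \<open>The induction hypothesis is applied to the sequences shifted by one, hence the
  generalization.\<close>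
proof (induction i arbitrary: y u)
  case (Suc i)
  have lin: "linear ((*v) A ^^ i)"
  proof (induction i)
    case (Suc i)
    then show ?case
      using linear_compose[OF _ matrix_vector_mul_linear[of A]] by (simp add: comp_def)
  qed (simp add: linear_iff)
  have "y (Suc i) - ((*v) A ^^ Suc i) (y 0) = (y (Suc i) - ((*v) A ^^ i) (y 1)) + ((*v) A ^^ i) (u 0)"
    by (simp add: Suc.prems[of 0] linear_add[OF lin] funpow_swap1)
  moreover have "norm (y (Suc i) - ((*v) A ^^ i) (y 1)) \<le> C * (\<Sum>j<i. norm (u (Suc j)))"
    using Suc.IH[of "\<lambda>n. y (Suc n)" "\<lambda>n. u (Suc n)"] Suc.prems by simp
  ultimately have "norm (y (Suc i) - ((*v) A ^^ Suc i) (y 0))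
      \<le> C * (\<Sum>j<i. norm (u (Suc j))) + C * norm (u 0)"
    using assms(1)[of i "u 0"] by (metis norm_triangle_mono)
  then show ?case
    by (simp add: sum.lessThan_Suc_shift distrib_left del: funpow.simps sum.lessThan_Suc)
qed simp

subsection \<open>Probability\<close>

text \<open>Markov's inequality at level \<open>s\<close>, in a form that includes
  \<open>s = 0\<close>. That value arises when the disturbance has zero norm.\<close>

lemma (in prob_space) Markov_inequality_complement:
  fixes S :: "'a \<Rightarrow> real"
  assumes "integrable M S" "\<And>\<omega>. 0 \<le> S \<omega>" "expectation S \<le> \<epsilon> * s" "0 \<le> s" "0 < \<epsilon>"
  shows "1 - \<epsilon> \<le> prob {\<omega> \<in> space M. S \<omega> \<le> s}"
proof -
  have [measurable]: "S \<in> borel_measurable M"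
    using assms(1) by auto
  show ?thesis
  proof (cases "s = 0")
    \<comment> \<open>Dividing by \<open>s\<close> is impossible here, but a nonnegative variable
      with mean zero vanishes almost surely.\<close>
    case True
    then have "expectation S = 0"
      using assms(2,3) by (simp add: antisym)
    then have "AE \<omega> in M. S \<omega> = 0"
      using integral_nonneg_eq_0_iff_AE[OF assms(1)] assms(2) by simp
    then have "prob {\<omega> \<in> space M. S \<omega> \<le> s} = 1"
      by (intro prob_eq_1[THEN iffD2]) (auto simp: True)
    with \<open>0 < \<epsilon>\<close> show ?thesis by simp
  next
    case False
    with \<open>0 \<le> s\<close> have s: "0 < s" by simp
    have "prob {\<omega> \<in> space M. S \<omega> \<ge> s} \<le> expectation S / s"
      using integral_Markov_inequality_measure[OF assms(1), of "{}" s] assms(2) s by simp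
    also have "\<dots> \<le> \<epsilon>"
      using assms(3) s by (simp add: pos_divide_le_eq)
    finally have "1 - \<epsilon> \<le> 1 - prob {\<omega> \<in> space M. S \<omega> \<ge> s}" by simp
    also have "\<dots> = prob (space M - {\<omega> \<in> space M. S \<omega> \<ge> s})"
      by (rule prob_compl[symmetric]) simp
    also have "\<dots> \<le> prob {\<omega> \<in> space M. S \<omega> \<le> s}"
      by (intro finite_measure_mono) auto
    finally show ?thesis .
  qed
qed

text \<open>Coordinatewise the product rule for independent real variables; independence makes first
  moments sufficient for integrability.\<close>

lemma (in prob_space) indep_var_inner:
  fixes X Y :: "'a \<Rightarrow> 'x::euclidean_space"
  assumes "indep_var borel X borel Y" "integrable M X" "integrable M Y"
  shows "integrable M (\<lambda>\<omega>. X \<omega> \<bullet> Y \<omega>)"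
    and "expectation (\<lambda>\<omega>. X \<omega> \<bullet> Y \<omega>) = expectation X \<bullet> expectation Y"
proof -
  have ind: "indep_var borel (\<lambda>\<omega>. X \<omega> \<bullet> b) borel (\<lambda>\<omega>. Y \<omega> \<bullet> b)" for b
    using indep_var_compose[OF assms(1), of "\<lambda>x. x \<bullet> b" borel "\<lambda>x. x \<bullet> b" borel] by (simp add: comp_def)
  have i: "integrable M (\<lambda>\<omega>. (X \<omega> \<bullet> b) * (Y \<omega> \<bullet> b))" for b
    using indep_var_integrable[OF ind] assms(2,3) by simp
  then show "integrable M (\<lambda>\<omega>. X \<omega> \<bullet> Y \<omega>)"
    by (subst euclidean_inner) simp
  have "expectation (\<lambda>\<omega>. X \<omega> \<bullet> Y \<omega>) = (\<Sum>b\<in>Basis. expectation (\<lambda>\<omega>. (X \<omega> \<bullet> b) * (Y \<omega> \<bullet> b)))"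
    by (subst euclidean_inner) (simp add: i)
  also have "\<dots> = (\<Sum>b\<in>Basis. (expectation X \<bullet> b) * (expectation Y \<bullet> b))"
    using indep_var_lebesgue_integral[OF ind] assms(2,3) by simp
  also have "\<dots> = expectation X \<bullet> expectation Y"
    by (rule euclidean_inner[symmetric])
  finally show "expectation (\<lambda>\<omega>. X \<omega> \<bullet> Y \<omega>) = expectation X \<bullet> expectation Y" .
qed

lemma (in prob_space) real_cond_exp_indep_noise:
  fixes X W :: "'a \<Rightarrow> 'x::euclidean_space"
  assumes ind: "indep_var borel X borel W"
    and [measurable]: "g \<in> borel_measurable borel" "u \<in> borel_measurable borel" "h \<in> borel_measurable borel"
    and g: "integrable M (\<lambda>\<omega>. g (X \<omega>))" and u: "integrable M (\<lambda>\<omega>. u (X \<omega>))"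
    and W: "integrable M W" "expectation W = 0" and h: "integrable M (\<lambda>\<omega>. h (W \<omega>))"
    and Y: "\<And>\<omega>. \<omega> \<in> space M \<Longrightarrow> Y \<omega> = g (X \<omega>) + W \<omega> \<bullet> u (X \<omega>) + h (W \<omega>)"
  shows "integrable M Y"
    and "AE \<omega> in M. real_cond_exp M (vimage_algebra (space M) X borel) Y \<omega>
      = g (X \<omega>) + expectation (\<lambda>\<omega>. h (W \<omega>))"
proof -
  have [measurable]: "X \<in> borel_measurable M" "W \<in> borel_measurable M"
    using indep_var_rv1[OF ind] indep_var_rv2[OF ind] by auto
  let ?F = "vimage_algebra (space M) X borel"
  have XF: "X \<in> borel_measurable ?F"
    by (rule measurable_vimage_algebra1) simp
  have "subalgebra M ?F"
    by (auto simp: subalgebra_def sets_vimage_algebra2)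
  then interpret F: sigma_finite_subalgebra M ?F
    by (intro finite_measure_subalgebra_is_sigma_finite finite_measure_subalgebra.intro
        finite_measure_subalgebra_axioms.intro) unfold_locales
  \<comment> \<open>Kept general because it serves both \<open>u\<close> and its restriction to a
    Borel set B.\<close>
  have ind_u: "indep_var borel (\<lambda>\<omega>. u' (X \<omega>)) borel W"
    if "u' \<in> borel_measurable borel" for u' :: "'x \<Rightarrow> 'x"
    using indep_var_compose[OF ind that measurable_ident] by (simp add: comp_def id_def)
  have cross: "integrable M (\<lambda>\<omega>. W \<omega> \<bullet> u (X \<omega>))"
    using indep_var_inner(1)[OF ind_u[OF assms(3)] u W(1)] by (simp add: inner_commute)
  show int: "integrable M Y"
    by (subst Bochner_Integration.integrable_cong[OF refl Y]) (use g h cross in auto)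
  show "AE \<omega> in M. real_cond_exp M ?F Y \<omega> = g (X \<omega>) + expectation (\<lambda>\<omega>. h (W \<omega>))"
  proof (rule F.real_cond_exp_charact[OF _ int])
    show "integrable M (\<lambda>\<omega>. g (X \<omega>) + expectation (\<lambda>\<omega>. h (W \<omega>)))"
      using g by simp
    show "(\<lambda>\<omega>. g (X \<omega>) + expectation (\<lambda>\<omega>. h (W \<omega>))) \<in> borel_measurable ?F"
      using XF by measurable
    fix S assume "S \<in> sets ?F"
    then obtain B where B[measurable]: "B \<in> sets borel" and S: "S = X -` B \<inter> space M"
      by (auto simp: sets_vimage_algebra2)
    then have [measurable]: "S \<in> sets M" by simp
    \<comment> \<open>The indicator of S is itself a function of X; absorbed into \<open>u\<close>,
      it leaves a product of independent factors, one of them centred.\<close>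
    have "expectation (\<lambda>\<omega>. indicator S \<omega> *\<^sub>R (W \<omega> \<bullet> u (X \<omega>)))
        = expectation (\<lambda>\<omega>. (indicator B (X \<omega>) *\<^sub>R u (X \<omega>)) \<bullet> W \<omega>)"
      by (intro Bochner_Integration.integral_cong) (auto simp: S indicator_def inner_commute)
    also have "\<dots> = 0"
    proof (subst indep_var_inner(2)[OF ind_u[of "\<lambda>x. indicator B x *\<^sub>R u x"] _ W(1)])
      show "integrable M (\<lambda>\<omega>. indicator B (X \<omega>) *\<^sub>R u (X \<omega>))"
        by (rule Bochner_Integration.integrable_bound[OF u]) (auto simp: indicator_def)
    qed (auto simp: W(2))
    finally have 1: "expectation (\<lambda>\<omega>. indicator S \<omega> *\<^sub>R (W \<omega> \<bullet> u (X \<omega>))) = 0" .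
    have "expectation (\<lambda>\<omega>. indicator S \<omega> *\<^sub>R h (W \<omega>))
        = expectation (\<lambda>\<omega>. indicator B (X \<omega>) * h (W \<omega>))"
      by (intro Bochner_Integration.integral_cong) (auto simp: S indicator_def)
    also have "\<dots> = expectation (\<lambda>\<omega>. indicator B (X \<omega>)) * expectation (\<lambda>\<omega>. h (W \<omega>))"
    proof (rule indep_var_lebesgue_integral[OF _ _ h])
      show "indep_var borel (\<lambda>\<omega>. indicator B (X \<omega>) :: real) borel (\<lambda>\<omega>. h (W \<omega>))"
        using indep_var_compose[OF ind, of "indicator B :: _ \<Rightarrow> real" borel h borel]
        by (simp add: comp_def)
      show "integrable M (\<lambda>\<omega>. indicator B (X \<omega>) :: real)"
        by (rule integrable_const_bound[of _ 1]) (auto simp: indicator_def)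
    qed
    also have "expectation (\<lambda>\<omega>. indicator B (X \<omega>)) = expectation (indicator S :: _ \<Rightarrow> real)"
      by (intro Bochner_Integration.integral_cong) (auto simp: S indicator_def)
    finally have 2: "expectation (\<lambda>\<omega>. indicator S \<omega> *\<^sub>R h (W \<omega>))
        = expectation (\<lambda>\<omega>. indicator S \<omega> *\<^sub>R expectation (\<lambda>\<omega>. h (W \<omega>)))"
      by simp
    have "set_integrable M S (\<lambda>\<omega>. g (X \<omega>))" "set_integrable M S (\<lambda>\<omega>. W \<omega> \<bullet> u (X \<omega>))"
      "set_integrable M S (\<lambda>\<omega>. h (W \<omega>))" "set_integrable M S (\<lambda>\<omega>. expectation (\<lambda>\<omega>. h (W \<omega>)))"
      unfolding set_integrable_def by (intro integrable_mult_indicator g h cross; simp)+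
    with 1 2 have "(LINT \<omega>:S|M. g (X \<omega>) + W \<omega> \<bullet> u (X \<omega>) + h (W \<omega>))
        = (LINT \<omega>:S|M. g (X \<omega>) + expectation (\<lambda>\<omega>. h (W \<omega>)))"
      unfolding set_lebesgue_integral_def set_integrable_def by (simp add: distrib_left)
    moreover have "(LINT \<omega>:S|M. Y \<omega>) = (LINT \<omega>:S|M. g (X \<omega>) + W \<omega> \<bullet> u (X \<omega>) + h (W \<omega>))"
      unfolding set_lebesgue_integral_def by (intro Bochner_Integration.integral_cong) (auto simp: Y)
    ultimately show "(LINT \<omega>:S|M. Y \<omega>) = (LINT \<omega>:S|M. g (X \<omega>) + expectation (\<lambda>\<omega>. h (W \<omega>)))"
      by simp
  qed
qed

subsection \<open>Disturbances and trajectories\<close>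

lemma in_Lp_2_iff:
  "in_Lp \<Omega> 2 X \<longleftrightarrow> X \<in> borel_measurable \<Omega> \<and> integrable \<Omega> (\<lambda>\<omega>. (norm (X \<omega>))\<^sup>2)"
  by (simp add: in_Lp_def)

lemma Lp_norm_2: "Lp_norm \<Omega> 2 X = sqrt (\<integral>\<omega>. (norm (X \<omega>))\<^sup>2 \<partial>\<Omega>)"
  by (simp add: Lp_norm_def powr_half_sqrt)

text \<open>The comparison of first and second moments is the nonnegativity of the variance of the
  norm.\<close>

lemma (in prob_space) in_Lp_2_imp_norm:
  assumes "in_Lp M 2 X"
  shows "integrable M (\<lambda>\<omega>. norm (X \<omega>))" "expectation (\<lambda>\<omega>. norm (X \<omega>)) \<le> Lp_norm M 2 X"
proof -
  have m: "X \<in> borel_measurable M" and i: "integrable M (\<lambda>\<omega>. (norm (X \<omega>))\<^sup>2)"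
    using assms by (auto simp: in_Lp_2_iff)
  show n: "integrable M (\<lambda>\<omega>. norm (X \<omega>))"
    using m by (intro square_integrable_imp_integrable[OF _ i]) simp
  have "(expectation (\<lambda>\<omega>. norm (X \<omega>)))\<^sup>2 \<le> expectation (\<lambda>\<omega>. (norm (X \<omega>))\<^sup>2)"
    using variance_eq[OF n i] variance_positive[of "\<lambda>\<omega>. norm (X \<omega>)"] by simp
  then show "expectation (\<lambda>\<omega>. norm (X \<omega>)) \<le> Lp_norm M 2 X"
    unfolding Lp_norm_2 by (rule real_le_rsqrt)
qed

lemma iid_process_integral_eq:
  fixes h :: "'x::euclidean_space \<Rightarrow> real"
  assumes "iid_process \<Omega> w" "\<And>k. w k \<in> borel_measurable \<Omega>" "h \<in> borel_measurable borel"
  shows "(\<integral>\<omega>. h (w k \<omega>) \<partial>\<Omega>) = (\<integral>\<omega>. h (w 0 \<omega>) \<partial>\<Omega>)"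
proof -
  have "distr \<Omega> borel (w k) = distr \<Omega> borel (w 0)"
    using assms(1) by (simp add: iid_process_def)
  then show ?thesis
    by (metis integral_distr[OF assms(2,3)])
qed

lemma iid_process_Lp_norm_eq:
  assumes "iid_process \<Omega> w" "\<And>k. w k \<in> borel_measurable \<Omega>"
  shows "Lp_norm \<Omega> p (w k) = Lp_norm \<Omega> p (w 0)"
  unfolding Lp_norm_def
  using iid_process_integral_eq[OF assms, of "\<lambda>x. norm x powr p" k] by simp

text \<open>The state \<open>x\<^sub>k\<close> as a function of \<open>x\<^sub>0, w\<^sub>0, \<dots>, w\<^sub>k\<^sub>-\<^sub>1\<close>, collected in one sequence.\<close>

primrec flow :: "('x \<Rightarrow> 'x \<Rightarrow> 'x) \<Rightarrow> nat \<Rightarrow> (nat \<Rightarrow> 'x) \<Rightarrow> 'x" where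
  "flow f 0 v = v 0"
| "flow f (Suc n) v = f (flow f n v) (v (Suc n))"

text \<open>The index set \<open>{..k}\<close> stays fixed while \<open>n\<close> varies, so that
  the induction never changes the product space.\<close>

lemma measurable_flow:
  fixes f :: "'x::euclidean_space \<Rightarrow> 'x \<Rightarrow> 'x"
  assumes [measurable]: "case_prod f \<in> borel_measurable (borel \<Otimes>\<^sub>M borel)"
  shows "n \<le> k \<Longrightarrow> flow f n \<in> borel_measurable (PiM {..k} (\<lambda>_. borel))"
proof (induction n)
  case 0
  show ?case
    unfolding flow.simps by (rule measurable_component_singleton) simp
next
  case (Suc n)
  have [measurable]: "flow f n \<in> borel_measurable (PiM {..k} (\<lambda>_. borel))"
    "(\<lambda>v. v (Suc n)) \<in> borel_measurable (PiM {..k} (\<lambda>_. borel :: 'x measure))"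
    using Suc by (auto intro!: measurable_component_singleton)
  show ?case
    unfolding flow.simps by measurable
qed

lemma trajectory_eq_flow:
  assumes "trajectory \<Omega> f w x" "\<omega> \<in> space \<Omega>" "n \<le> k"
  shows "x n \<omega> = flow f n (restrict (\<lambda>i. case_nat (x 0) w i \<omega>) {..k})"
  using assms(3) by (induction n) (use assms(1,2) in \<open>auto simp: trajectory_def\<close>)

lemma (in prob_space) indep_var_cong:
  assumes "indep_var S X T Y" "\<And>\<omega>. \<omega> \<in> space M \<Longrightarrow> X \<omega> = X' \<omega>" "\<And>\<omega>. \<omega> \<in> space M \<Longrightarrow> Y \<omega> = Y' \<omega>"
  shows "indep_var S X' T Y'"
proof -
  have "X -` B \<inter> space M = X' -` B \<inter> space M" "Y -` C \<inter> space M = Y' -` C \<inter> space M" for B C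
    using assms(2,3) by auto
  with assms(1) show ?thesis
    unfolding indep_var_eq using measurable_cong[of M X X' S] measurable_cong[of M Y Y' T] assms(2,3)
    by simp
qed

text \<open>The current state depends only on the initial state and earlier disturbances; disjoint
  blocks of an independent family are independent.\<close>

lemma trajectory_indep_var:
  fixes f :: "'x::euclidean_space \<Rightarrow> 'x \<Rightarrow> 'x"
  assumes "prob_space \<Omega>" "trajectory \<Omega> f w x" "case_prod f \<in> borel_measurable (borel \<Otimes>\<^sub>M borel)"
  shows "prob_space.indep_var \<Omega> borel (x k) borel (w k)"
proof -
  interpret prob_space \<Omega> by fact
  let ?X = "case_nat (x 0) w"
  have "indep_vars (\<lambda>_. borel) ?X UNIV"
    using assms(2) by (simp add: trajectory_def)
  \<comment> \<open>In the combined family index 0 holds \<open>x 0\<close>, so \<open>w k\<close>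
    sits at \<open>Suc k\<close> and the state \<open>x k\<close> uses the indices up to
    \<open>k\<close>.\<close>
  then have "indep_var (PiM {..k} (\<lambda>_. borel)) (\<lambda>\<omega>. restrict (\<lambda>i. ?X i \<omega>) {..k})
      (PiM {Suc k} (\<lambda>_. borel)) (\<lambda>\<omega>. restrict (\<lambda>i. ?X i \<omega>) {Suc k})"
    by (rule indep_var_restrict) auto
  then have "indep_var borel (flow f k \<circ> (\<lambda>\<omega>. restrict (\<lambda>i. ?X i \<omega>) {..k}))
      borel ((\<lambda>v. v (Suc k)) \<circ> (\<lambda>\<omega>. restrict (\<lambda>i. ?X i \<omega>) {Suc k}))"
    by (rule indep_var_compose)
      (auto intro!: measurable_flow[OF assms(3)] measurable_component_singleton)
  then show ?thesis
    by (rule indep_var_cong) (simp_all add: trajectory_eq_flow[OF assms(2) _ order_refl, symmetric])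
qed

lemma measurable_linear_system:
  "(\<lambda>(x, w). (A :: real^'n^'n) *v x + w) \<in> borel_measurable (borel \<Otimes>\<^sub>M borel)"
proof -
  have [measurable]: "(*v) A \<in> borel_measurable borel"
    by (intro borel_measurable_continuous_onI matrix_vector_mult_linear_continuous_on)
  show ?thesis by measurable
qed

subsection \<open>Linear systems with a quadratic Lyapunov function\<close>

text \<open>One random variable, C times the sum of N noise norms, dominates the deviation from the
  nominal motion at all times \<open>i \<le> N\<close>, so a single use of Markov's inequality
  covers the whole horizon.\<close>

lemma linear_system_ISSp:
  fixes A P :: "real^'n^'n"
  assumes "pos_definite P" "pos_definite (- (transpose A ** P ** A - P))"
  shows "ISSp 2 W (\<lambda>x w. A *v x + w)"
  unfolding ISSp_def
proof (intro ballI allI impI)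
  fix \<epsilon> :: real and N :: nat and \<Omega> :: "'a measure" and w :: "nat \<Rightarrow> 'a \<Rightarrow> real^'n"
  assume \<epsilon>: "\<epsilon> \<in> {0<..<1}" and "iid_process \<Omega> w \<and> W \<Omega> w \<and> (\<forall>k. in_Lp \<Omega> 2 (w k))"
  then have iid: "iid_process \<Omega> w" and Lp: "\<And>k. in_Lp \<Omega> 2 (w k)" by auto
  interpret prob_space \<Omega>
    using iid by (simp add: iid_process_def)
  have w[measurable]: "\<And>k. w k \<in> borel_measurable \<Omega>"
    using Lp by (simp add: in_Lp_def)
  obtain C \<gamma> where C: "0 < C" "0 < \<gamma>"
    "\<And>i z. norm (((*v) A ^^ i) z) \<le> C * norm z * exp (- \<gamma> * real i)"
    using quadratic_lyapunov_power_bound[OF assms] by blast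
  have C': "norm (((*v) A ^^ i) z) \<le> C * norm z" for i z
  proof -
    have "exp (- \<gamma> * real i) \<le> 1" using C(2) by simp
    then show ?thesis
      using order_trans[OF C(3)[of i z] mult_left_le[of "exp (- \<gamma> * real i)" "C * norm z"]] C(1) by simp
  qed
  let ?L = "Lp_norm \<Omega> 2 (w 0)"
  let ?\<beta> = "\<lambda>r t. C * r * exp (- \<gamma> * t)"
  \<comment> \<open>The summand \<open>1\<close> keeps \<open>\<rho>\<close> strictly increasing when \<open>N = 0\<close>.\<close>
  let ?\<rho> = "\<lambda>r. (C * real N / \<epsilon> + 1) * r"
  have pos: "0 < C * real N / \<epsilon> + 1"
    using C(1) \<epsilon> by (intro add_nonneg_pos) auto
  show "\<exists>\<beta> \<rho>. class_KL \<beta> \<and> class_K \<rho> \<and>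
      (\<forall>x k. trajectory \<Omega> (\<lambda>x w. A *v x + w) w x \<longrightarrow>
        1 - \<epsilon> \<le> prob {\<omega> \<in> space \<Omega>. \<forall>i\<le>N. norm (x (k + i) \<omega>) \<le> \<beta> (norm (x k \<omega>)) (real i) + \<rho> ?L})"
  proof (intro exI[of _ ?\<beta>] exI[of _ ?\<rho>] conjI allI impI)
    show "class_KL ?\<beta>" "class_K ?\<rho>"
      using class_KL_exponential[OF C(1,2)] class_K_linear[OF pos] by auto
    fix x k assume traj: "trajectory \<Omega> (\<lambda>x w. A *v x + w) w x"
    \<comment> \<open>Independence contains measurability of the states, which makes the final event
      measurable.\<close>
    have [measurable]: "x n \<in> borel_measurable \<Omega>" for n
      using indep_var_rv1[OF trajectory_indep_var[OF prob_space_axioms traj measurable_linear_system]] .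
    define S where "S \<omega> = C * (\<Sum>j<N. norm (w (k + j) \<omega>))" for \<omega>
    have S_int: "integrable \<Omega> S"
      unfolding S_def using in_Lp_2_imp_norm(1)[OF Lp] by simp
    have "expectation S = C * (\<Sum>j<N. expectation (\<lambda>\<omega>. norm (w (k + j) \<omega>)))"
      unfolding S_def using in_Lp_2_imp_norm(1)[OF Lp] by simp
    also have "\<dots> \<le> C * (\<Sum>j<N. ?L)"
    proof (intro mult_left_mono sum_mono)
      show "expectation (\<lambda>\<omega>. norm (w (k + j) \<omega>)) \<le> ?L" for j
        using in_Lp_2_imp_norm(2)[OF Lp] iid_process_Lp_norm_eq[OF iid w, of 2 "k + j"] by metis
    qed (use C(1) in simp)
    \<comment> \<open>The gain is chosen for this: \<open>\<epsilon> * ?\<rho> ?L\<close> equals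
      \<open>(C * real N + \<epsilon>) * ?L\<close>.\<close>
    also have "\<dots> \<le> \<epsilon> * ?\<rho> ?L"
      using \<epsilon> by (simp add: Lp_norm_def field_simps)
    finally have "expectation S \<le> \<epsilon> * ?\<rho> ?L" .
    then have "1 - \<epsilon> \<le> prob {\<omega> \<in> space \<Omega>. S \<omega> \<le> ?\<rho> ?L}"
      using \<epsilon> C(1) pos
      by (intro Markov_inequality_complement[OF S_int])
        (auto simp: S_def Lp_norm_def intro!: mult_nonneg_nonneg sum_nonneg)
    also have "\<dots> \<le> prob {\<omega> \<in> space \<Omega>. \<forall>i\<le>N. norm (x (k + i) \<omega>) \<le> ?\<beta> (norm (x k \<omega>)) (real i) + ?\<rho> ?L}"
    proof (rule finite_measure_mono)
      show "{\<omega> \<in> space \<Omega>. \<forall>i\<le>N. norm (x (k + i) \<omega>) \<le> ?\<beta> (norm (x k \<omega>)) (real i) + ?\<rho> ?L} \<in> events"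
        by measurable
      show "{\<omega> \<in> space \<Omega>. S \<omega> \<le> ?\<rho> ?L}
          \<subseteq> {\<omega> \<in> space \<Omega>. \<forall>i\<le>N. norm (x (k + i) \<omega>) \<le> ?\<beta> (norm (x k \<omega>)) (real i) + ?\<rho> ?L}"
      proof (safe, goal_cases)
        case (1 \<omega> i)
        have "norm (x (k + i) \<omega> - ((*v) A ^^ i) (x k \<omega>)) \<le> C * (\<Sum>j<i. norm (w (k + j) \<omega>))"
          using linear_recursion_perturbation_bound[OF C', of "\<lambda>n. x (k + n) \<omega>" "\<lambda>n. w (k + n) \<omega>" i]
            traj 1(1) by (simp add: trajectory_def)
        also have "\<dots> \<le> S \<omega>"
          unfolding S_def using C(1) 1(3) by (intro mult_left_mono sum_mono2) auto
        finally have "norm (x (k + i) \<omega>) \<le> norm (((*v) A ^^ i) (x k \<omega>)) + S \<omega>"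
          using norm_triangle_sub[of "x (k + i) \<omega>" "((*v) A ^^ i) (x k \<omega>)"] by simp
        with C(3)[of i "x k \<omega>"] 1(2) show ?case by linarith
      qed
    qed
    finally show "1 - \<epsilon> \<le> prob {\<omega> \<in> space \<Omega>.
        \<forall>i\<le>N. norm (x (k + i) \<omega>) \<le> ?\<beta> (norm (x k \<omega>)) (real i) + ?\<rho> ?L}" .
  qed
qed

text \<open>Conditioning leaves the nominal decrease, at most \<open>- c * V\<close>, plus the mean
  of V at the noise, at most M times the squared norm of the disturbance.\<close>

lemma quadratic_ISSp_lyapunov_function:
  fixes A P :: "real^'n^'n"
  assumes "pos_definite P" "pos_definite (- (transpose A ** P ** A - P))"
  shows "ISSp_lyapunov_function 2
    (zero_mean_bounded_cov :: 'a measure \<Rightarrow> (nat \<Rightarrow> 'a \<Rightarrow> real^'n) \<Rightarrow> bool)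
    (\<lambda>x w. A *v x + w) UNIV (\<lambda>x. x \<bullet> (P *v x))"
proof -
  define V where "V x = x \<bullet> (P *v x)" for x
  obtain c where c: "0 < c" "c < 1" "\<And>z. V (A *v z) \<le> (1 - c) * V z"
    using quadratic_lyapunov_contraction[OF assms] unfolding V_def by blast
  obtain m where m: "0 < m" "\<And>z. m * (norm z)\<^sup>2 \<le> V z"
    using pos_definite_lower_bound[OF assms(1)] unfolding V_def by blast
  obtain M where M: "0 < M" "\<And>z. \<bar>V z\<bar> \<le> M * (norm z)\<^sup>2"
    using quadratic_form_upper_bound[of P] unfolding V_def by blast
  have V0: "0 \<le> V x" for x
    using m(2)[of x] m(1) by (meson less_imp_le mult_nonneg_nonneg order_trans zero_le_power2)
  have lin: "bounded_linear ((*v) Q)" for Q :: "real^'n^'n"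
    by (rule matrix_vector_mul_bounded_linear)
  have V_cont: "continuous_on UNIV V"
    unfolding V_def by (intro continuous_intros matrix_vector_mult_linear_continuous_on)
  then have [measurable]: "V \<in> borel_measurable borel"
    by (rule borel_measurable_continuous_onI)
  have mat[measurable]: "(*v) Q \<in> borel_measurable borel" for Q :: "real^'n^'n"
    by (intro borel_measurable_continuous_onI matrix_vector_mult_linear_continuous_on)
  have V_add: "V (A *v x + w) - V x = (V (A *v x) - V x) + w \<bullet> (2 *\<^sub>R (P *v (A *v x))) + V w" for x w
    using quadratic_form_add[of P "A *v x" w] assms(1) by (simp add: V_def pos_definite_def)
  have step: "integrable \<Omega> (\<lambda>\<omega>. V (x (Suc k) \<omega>)) \<and>
      (AE \<omega> in \<Omega>. real_cond_exp \<Omega> (vimage_algebra (space \<Omega>) (x k) borel)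
          (\<lambda>\<omega>'. V (x (Suc k) \<omega>') - V (x k \<omega>')) \<omega>
        \<le> - (c * V (x k \<omega>)) + M * (Lp_norm \<Omega> 2 (w 0))\<^sup>2)"
    if iid: "iid_process \<Omega> w" and zm: "zero_mean_bounded_cov \<Omega> w" and Lp: "\<forall>j. in_Lp \<Omega> 2 (w j)"
      and traj: "trajectory \<Omega> (\<lambda>x w. A *v x + w) w x" and Vx: "integrable \<Omega> (\<lambda>\<omega>. V (x k \<omega>))"
    for \<Omega> :: "'a measure" and w x k
  proof -
    interpret prob_space \<Omega>
      using iid by (simp add: iid_process_def)
    have w[measurable]: "\<And>k. w k \<in> borel_measurable \<Omega>" and w2: "\<And>k. integrable \<Omega> (\<lambda>\<omega>. (norm (w k \<omega>))\<^sup>2)"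
      using Lp by (auto simp: in_Lp_2_iff)
    have ind: "indep_var borel (x k) borel (w k)"
      by (rule trajectory_indep_var[OF prob_space_axioms traj measurable_linear_system])
    then have [measurable]: "x k \<in> borel_measurable \<Omega>"
      by (rule indep_var_rv1)
    have "has_bochner_integral \<Omega> (w k) 0"
      using zm by (auto simp: zero_mean_bounded_cov_def)
    then have W: "integrable \<Omega> (w k)" "expectation (w k) = 0"
      by (simp_all add: has_bochner_integral_iff)
    have Vw: "integrable \<Omega> (\<lambda>\<omega>. V (w k \<omega>))"
      by (rule Bochner_Integration.integrable_bound[OF integrable_mult_right[OF w2[of k], of M]])
        (use M in auto)
    have Vw_le: "expectation (\<lambda>\<omega>. V (w k \<omega>)) \<le> M * (Lp_norm \<Omega> 2 (w 0))\<^sup>2"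
    proof -
      have "expectation (\<lambda>\<omega>. V (w k \<omega>)) \<le> expectation (\<lambda>\<omega>. M * (norm (w k \<omega>))\<^sup>2)"
        using M(2) by (intro integral_mono Vw integrable_mult_right w2) (metis abs_le_D1)
      also have "\<dots> = M * expectation (\<lambda>\<omega>. (norm (w 0 \<omega>))\<^sup>2)"
        using iid_process_integral_eq[OF iid w, of "\<lambda>x. (norm x)\<^sup>2" k] by simp
      finally show ?thesis
        by (simp add: Lp_norm_2)
    qed
    \<comment> \<open>The contraction and nonnegativity of V give domination by
      \<open>V (x k \<omega>)\<close>.\<close>
    have VAx: "integrable \<Omega> (\<lambda>\<omega>. V (A *v x k \<omega>))"
    proof (rule Bochner_Integration.integrable_bound[OF Vx])
      have "V (A *v z) \<le> V z" for z
        using c(3)[of z] mult_nonneg_nonneg[OF less_imp_le[OF c(1)] V0[of z]]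
        by (simp add: left_diff_distrib)
      then show "AE \<omega> in \<Omega>. norm (V (A *v x k \<omega>)) \<le> norm (V (x k \<omega>))"
        using V0 by simp
    qed simp
    \<comment> \<open>The lower bound on V turns integrability of \<open>V (x k \<omega>)\<close>
      into a second, hence a first, moment of the state; the factor of the noise in the cross term
      is linear in the state.\<close>
    have "norm ((norm z)\<^sup>2) \<le> norm (1 / m * V z)" for z
      using m(2)[of z] m(1) V0[of z] by (simp add: field_simps)
    then have "integrable \<Omega> (\<lambda>\<omega>. (norm (x k \<omega>))\<^sup>2)"
      by (intro Bochner_Integration.integrable_bound[OF integrable_mult_right[OF Vx, of "1 / m"]]) auto
    then have "integrable \<Omega> (\<lambda>\<omega>. norm (x k \<omega>))"
      by (rule square_integrable_imp_integrable[rotated]) simp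
    then have "integrable \<Omega> (x k)"
      by (subst (asm) integrable_norm_iff) auto
    then have U: "integrable \<Omega> (\<lambda>\<omega>. 2 *\<^sub>R (P *v (A *v x k \<omega>)))"
      by (intro integrable_scaleR_right integrable_bounded_linear[OF lin])
    have eq: "V (x (Suc k) \<omega>) - V (x k \<omega>)
        = (V (A *v x k \<omega>) - V (x k \<omega>)) + w k \<omega> \<bullet> (2 *\<^sub>R (P *v (A *v x k \<omega>))) + V (w k \<omega>)"
      if "\<omega> \<in> space \<Omega>" for \<omega>
      using traj that V_add by (simp add: trajectory_def)
    note noise = real_cond_exp_indep_noise[OF ind, of "\<lambda>z. V (A *v z) - V z" "\<lambda>z. 2 *\<^sub>R (P *v (A *v z))" V,
        OF _ _ _ Bochner_Integration.integrable_diff[OF VAx Vx] U W Vw eq]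
    have D: "integrable \<Omega> (\<lambda>\<omega>. V (x (Suc k) \<omega>) - V (x k \<omega>))"
      by (rule noise(1)) auto
    show ?thesis
    proof
      \<comment> \<open>The noise lemma treats the increment of V; adding back the integrable
        current value gives the next one.\<close>
      show "integrable \<Omega> (\<lambda>\<omega>. V (x (Suc k) \<omega>))"
        using Bochner_Integration.integrable_add[OF D Vx] by simp
      show "AE \<omega> in \<Omega>. real_cond_exp \<Omega> (vimage_algebra (space \<Omega>) (x k) borel)
          (\<lambda>\<omega>'. V (x (Suc k) \<omega>') - V (x k \<omega>')) \<omega>
        \<le> - (c * V (x k \<omega>)) + M * (Lp_norm \<Omega> 2 (w 0))\<^sup>2"
      proof -
        have "AE \<omega> in \<Omega>. real_cond_exp \<Omega> (vimage_algebra (space \<Omega>) (x k) borel)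
            (\<lambda>\<omega>. V (x (Suc k) \<omega>) - V (x k \<omega>)) \<omega>
          = V (A *v x k \<omega>) - V (x k \<omega>) + expectation (\<lambda>\<omega>. V (w k \<omega>))"
          by (rule noise(2)) auto
        then show ?thesis
        proof eventually_elim
          case (elim \<omega>)
          then show ?case
            using c(3)[of "x k \<omega>"] Vw_le by (simp add: left_diff_distrib)
        qed
      qed
    qed
  qed
  show ?thesis
    unfolding ISSp_lyapunov_function_def V_def[symmetric]
  \<comment> \<open>The witnesses are, in order, \<open>\<alpha>1\<close>, \<open>\<alpha>2\<close>,
    \<open>\<kappa>\<close> and \<open>\<phi>\<close>: both quadratic bounds of V, the contraction
    defect, and the upper bound again for the noise.\<close>
  proof (intro conjI allI V_cont V0, rule exI[of _ "\<lambda>r. m * r\<^sup>2"], rule exI[of _ "\<lambda>r. M * r\<^sup>2"],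
      rule exI[of _ "\<lambda>r. c * r"], rule exI[of _ "\<lambda>r. M * r\<^sup>2"],
      intro conjI class_K_inf_square class_K_inf_linear class_K_square m(1) M(1) c(1), goal_cases)
    case 1
    show ?case
      using m(2) M(2) by (meson abs_le_D1)
  next
    case 2
    show ?case
    proof (intro allI impI, goal_cases)
      case (1 \<Omega> w x k)
      with step[of \<Omega> w x k] show ?case by blast
    qed
  qed
qed

theorem theorem1:
  fixes A P :: "real^'n^'n"
  assumes "asymptotically_stable (\<lambda>z. A *v z)"
    and "pos_definite P"
    and "lyapunov_function (\<lambda>z. A *v z) (\<lambda>z. z \<bullet> (P *v z))"
    and "pos_definite (- (transpose A ** P ** A - P))"
  shows "ISSp 2
           (zero_mean_bounded_cov :: 'a measure \<Rightarrow> (nat \<Rightarrow> 'a \<Rightarrow> real^'n) \<Rightarrow> bool)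
           (\<lambda>x w. A *v x + w) \<and>
         ISSp_lyapunov_function 2
           (zero_mean_bounded_cov :: 'a measure \<Rightarrow> (nat \<Rightarrow> 'a \<Rightarrow> real^'n) \<Rightarrow> bool)
           (\<lambda>x w. A *v x + w) UNIV (\<lambda>x. x \<bullet> (P *v x))"
  using linear_system_ISSp[OF assms(2,4)] quadratic_ISSp_lyapunov_function[OF assms(2,4)] by blast

end
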